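(* Let $n,k$ be positive integers and let $\mu\subset\lambda$ be two partitions with $|\lambda/\mu|=kn$. If $\lambda/\mu$ is not a horizontal $n$-border strip of weight $k$, then $\det(\mathcal{M}(\lambda/\mu))=0$.
   Context: For partitions, $\mu\subset\lambda$ means $\mu_i\le\lambda_i$ for all $i$, $|\lambda/\mu|=|\lambda|-|\mu|$, and $\ell(\lambda)$ is the number of nonzero parts. Young diagrams are drawn with rows numbered from top to bottom and columns from left to right. Matrix: for $\mu\subset\lambda$, $\mathcal{M}(\lambda/\mu)=(m_{ij})$ is the $\ell(\lambda)\times\ell(\lambda)$ matrix with $m_{ij}=1$ if $\lambda_i-i\ge\mu_j-j$ and $n\mid(\lambda_i-i-\mu_j+j)$, and $m_{ij}=0$ otherwise ($\mu$ padded with zeros at the end if $\ell(\mu)<\ell(\lambda)$). Border strips: a skew diagram is an $r$-border strip if it consists of $r$ boxes, is connected and contains no $2\times 2$ square. Its starting box is its northeasternmost box. $(\lambda/\mu)\!\uparrow$ is the set consisting of the top box of each (nonempty) column of $\lambda/\mu$. Horizontal $n$-border strip: $\lambda/\mu$ is a horizontal $n$-border strip of weight $k$ if there is a chain of partitions $\mu=\alpha^{(0)}\subset\alpha^{(1)}\subset\cdots\subset\alpha^{(k)}=\lambda$ such that each $\alpha^{(i)}/\alpha^{(i-1)}$ is an $n$-border strip, the starting box of each $\alpha^{(i)}/\alpha^{(i-1)}$ lies in $(\lambda/\mu)\!\uparrow$, and for $i<j$ the starting box of $\alpha^{(i)}/\alpha^{(i-1)}$ lies southwest (weakly below and strictly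 to the left) of the starting box of $\alpha^{(j)}/\alpha^{(j-1)}$. *)

theory Defs
  imports "Jordan_Normal_Form.Determinant"
begin

text \<open>A partition is a weakly decreasing, eventually zero sequence of natural numbers, so padding
  with zeros is built in, and \<open>\<mu> \<subset> \<lambda>\<close> is the pointwise order \<open>\<le>\<close> on functions. Indices
  are 0-based throughout: \<open>p i\<close> is the part usually written with index \<open>i + 1\<close>, and the box
  \<open>(i, j)\<close> lies in the \<open>i + 1\<close>-st row from the top and the \<open>j + 1\<close>-st column from the left.\<close>

definition is_partition :: "(nat \<Rightarrow> nat) \<Rightarrow> bool" where
  "is_partition p \<longleftrightarrow> antimono p \<and> finite {i. p i \<noteq> 0}"

definition partition_size :: "(nat \<Rightarrow> nat) \<Rightarrow> nat" where
  "partition_size p = (\<Sum>i | p i \<noteq> 0. p i)"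

definition num_parts :: "(nat \<Rightarrow> nat) \<Rightarrow> nat" where
  "num_parts p = card {i. p i \<noteq> 0}"

definition skew_size :: "(nat \<Rightarrow> nat) \<Rightarrow> (nat \<Rightarrow> nat) \<Rightarrow> nat" where
  "skew_size lam mu = partition_size lam - partition_size mu"

definition skew_diagram :: "(nat \<Rightarrow> nat) \<Rightarrow> (nat \<Rightarrow> nat) \<Rightarrow> (nat \<times> nat) set" where
  "skew_diagram lam mu = {(i, j). mu i \<le> j \<and> j < lam i}"

text \<open>Shifting rows and columns to 0-based indices does not change the entries, since only
  \<open>(\<lambda>\<^sub>i - i) - (\<mu>\<^sub>j - j)\<close> enters.\<close>

definition strip_matrix :: "nat \<Rightarrow> (nat \<Rightarrow> nat) \<Rightarrow> (nat \<Rightarrow> nat) \<Rightarrow> int mat" where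
  "strip_matrix n lam mu = mat (num_parts lam) (num_parts lam)
     (\<lambda>(i, j). if int (lam i) - int i \<ge> int (mu j) - int j
                  \<and> int n dvd (int (lam i) - int i - int (mu j) + int j)
               then 1 else 0)"

definition adjacent_boxes :: "nat \<times> nat \<Rightarrow> nat \<times> nat \<Rightarrow> bool" where
  "adjacent_boxes b c \<longleftrightarrow>
     \<bar>int (fst b) - int (fst c)\<bar> + \<bar>int (snd b) - int (snd c)\<bar> = 1"

definition connected_boxes :: "(nat \<times> nat) set \<Rightarrow> bool" where
  "connected_boxes D \<longleftrightarrow>
     (\<forall>b\<in>D. \<forall>c\<in>D. (b, c) \<in> {(x, y). x \<in> D \<and> y \<in> D \<and> adjacent_boxes x y}\<^sup>*)"

text \<open>Only meant for \<open>D\<close> a skew diagram and \<open>r > 0\<close> (\<open>card\<close> is also 0 on infinite sets).\<close>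

definition border_strip :: "nat \<Rightarrow> (nat \<times> nat) set \<Rightarrow> bool" where
  "border_strip r D \<longleftrightarrow> card D = r \<and> connected_boxes D
     \<and> \<not> (\<exists>i j. {(i, j), (Suc i, j), (i, Suc j), (Suc i, Suc j)} \<subseteq> D)"

text \<open>The northeasternmost box: weakly above and weakly to the right of every box. It exists and is
  unique for every nonempty skew diagram, namely the last box of the first nonempty row.\<close>

definition starting_box :: "(nat \<times> nat) set \<Rightarrow> nat \<times> nat" where
  "starting_box D = (THE b. b \<in> D \<and> (\<forall>c\<in>D. fst b \<le> fst c \<and> snd c \<le> snd b))"

definition top_boxes :: "(nat \<times> nat) set \<Rightarrow> (nat \<times> nat) set" where
  "top_boxes D = {(i, j) \<in> D. \<forall>i'. (i', j) \<in> D \<longrightarrow> i \<le> i'}"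

definition southwest_of :: "nat \<times> nat \<Rightarrow> nat \<times> nat \<Rightarrow> bool" where
  "southwest_of b c \<longleftrightarrow> fst c \<le> fst b \<and> snd b < snd c"

definition horizontal_border_strip ::
    "nat \<Rightarrow> nat \<Rightarrow> (nat \<Rightarrow> nat) \<Rightarrow> (nat \<Rightarrow> nat) \<Rightarrow> bool" where
  "horizontal_border_strip n k lam mu \<longleftrightarrow>
     (\<exists>\<alpha> :: nat \<Rightarrow> nat \<Rightarrow> nat.
        \<alpha> 0 = mu \<and> \<alpha> k = lam
      \<and> (\<forall>i\<le>k. is_partition (\<alpha> i))
      \<and> (\<forall>i\<in>{1..k}. \<alpha> (i - 1) \<le> \<alpha> i
           \<and> border_strip n (skew_diagram (\<alpha> i) (\<alpha> (i - 1)))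
           \<and> starting_box (skew_diagram (\<alpha> i) (\<alpha> (i - 1))) \<in> top_boxes (skew_diagram lam mu))
      \<and> (\<forall>i\<in>{1..k}. \<forall>j\<in>{1..k}. i < j \<longrightarrow>
           southwest_of (starting_box (skew_diagram (\<alpha> i) (\<alpha> (i - 1))))
                        (starting_box (skew_diagram (\<alpha> j) (\<alpha> (j - 1))))))"

end

theory Submission
  imports Defs
begin

text \<open>Encode a partition \<open>\<alpha>\<close> by its beads \<open>\<alpha> i - i\<close>. Within a residue class modulo \<open>n\<close>, the
  matrix is a staircase of zeros and ones, so it is singular unless the beads of \<open>\<lambda>\<close> and \<open>\<mu>\<close> in
  this class interlace. If they do, take the first row \<open>p\<close> in which \<open>\<lambda>\<close> and \<open>\<mu>\<close> differ and let
  \<open>t\<close> be the bead of \<open>\<lambda>\<close> in this row: interlacing forces position \<open>t - n\<close> to be vacant, and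
  moving the bead there removes from \<open>\<lambda>\<close> an \<open>n\<close>-border strip starting at the end of row \<open>p\<close> and
  keeps the beads interlaced. Iterating yields the chain of a horizontal \<open>n\<close>-border strip.\<close>

section \<open>Vanishing determinants\<close>

text \<open>By the pigeonhole principle every permutation sends some row of \<open>S\<close> to a
  column outside \<open>T\<close>, so each term of the Leibniz expansion has a zero factor.\<close>

lemma det_zero_if_rows_supported:
  fixes M :: "'a :: comm_ring_1 mat"
  assumes M: "M \<in> carrier_mat m m" and S: "S \<subseteq> {..<m}" and T: "finite T" "card T < card S"
    and zero: "\<And>i j. i \<in> S \<Longrightarrow> j < m \<Longrightarrow> j \<notin> T \<Longrightarrow> M $$ (i, j) = 0"
  shows "det M = 0"
proof -
  have "(\<Prod>i = 0..<m. M $$ (i, \<pi> i)) = 0" if \<pi>: "\<pi> permutes {0..<m}" for \<pi>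
  proof -
    have "\<not> \<pi> ` S \<subseteq> T"
      using card_inj_on_le[OF inj_on_subset[OF permutes_inj[OF \<pi>]], of S T] T by auto
    then obtain i where i: "i \<in> S" "\<pi> i \<notin> T" by auto
    moreover have "i < m" using i S by auto
    moreover have "\<pi> i < m" using permutes_in_image[OF \<pi>, of i] \<open>i < m\<close> by simp
    ultimately show ?thesis using zero by (intro prod_zero) (auto intro!: bexI[of _ i])
  qed
  then show ?thesis using M by (simp add: det_def)
qed

lemma det_zero_if_columns_supported:
  fixes M :: "'a :: comm_ring_1 mat"
  assumes M: "M \<in> carrier_mat m m" and S: "S \<subseteq> {..<m}" and T: "finite T" "card T < card S"
    and zero: "\<And>i j. j \<in> S \<Longrightarrow> i < m \<Longrightarrow> i \<notin> T \<Longrightarrow> M $$ (i, j) = 0"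
  shows "det M = 0"
proof -
  have "det M\<^sup>T = 0"
    using S zero M by (intro det_zero_if_rows_supported[of _ m S T] T) auto
  then show ?thesis using det_transpose[OF M] by simp
qed

lemma det_subtract_row:
  fixes M :: "'a :: comm_ring_1 mat"
  assumes M: "M \<in> carrier_mat m m" and k: "k < m" and "finite S" "S \<subseteq> {..<m}" "k \<notin> S"
  shows "det (mat m m (\<lambda>(i, j). if i \<in> S then M $$ (i, j) - M $$ (k, j) else M $$ (i, j))) = det M"
  using assms(3-5)
proof (induction S rule: finite_induct)
  case empty
  have "mat m m (\<lambda>(i, j). M $$ (i, j)) = M" using M by (intro eq_matI) auto
  then show ?case by simp
next
  case (insert l S)
  let ?N = "\<lambda>S. mat m m (\<lambda>(i, j). if i \<in> S then M $$ (i, j) - M $$ (k, j) else M $$ (i, j))"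
  \<comment> \<open>Row \<open>k\<close> is still untouched in \<open>?N S\<close> because
    \<open>k\<close> is not in \<open>S\<close>, so a single elementary row operation treats the new
    row \<open>l\<close>.\<close>
  have "?N (insert l S) = addrow (-1) l k (?N S)"
    using insert k by (intro eq_matI) auto
  also have "det \<dots> = det (?N S)"
    using insert.prems k by (intro det_addrow[of _ m]) auto
  finally show ?case using insert by simp
qed

text \<open>Subtracting one row of \<open>S\<close> from the others preserves the determinant and
  leaves \<open>card S - 1 > card T\<close> rows that vanish outside \<open>T\<close>.\<close>

lemma det_zero_if_rows_agree:
  fixes M :: "'a :: comm_ring_1 mat"
  assumes M: "M \<in> carrier_mat m m" and S: "S \<subseteq> {..<m}" and T: "finite T" "card T + 1 < card S"
    and agree: "\<And>i i' j. i \<in> S \<Longrightarrow> i' \<in> S \<Longrightarrow> j < m \<Longrightarrow> j \<notin> T \<Longrightarrow> M $$ (i, j) = M $$ (i', j)"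
  shows "det M = 0"
proof -
  from T have "S \<noteq> {}" by auto
  then obtain k where k: "k \<in> S" by auto
  have finS: "finite S" using S finite_subset by blast
  let ?N = "mat m m (\<lambda>(i, j). if i \<in> S - {k} then M $$ (i, j) - M $$ (k, j) else M $$ (i, j))"
  have "det ?N = 0"
  proof (rule det_zero_if_rows_supported[of _ m "S - {k}" T])
    show "card T < card (S - {k})" using T k finS by simp
    show "?N $$ (i, j) = 0" if "i \<in> S - {k}" "j < m" "j \<notin> T" for i j
      using that agree[of i k j] k S by auto
  qed (use S T in auto)
  then show ?thesis using det_subtract_row[OF M, of k "S - {k}"] k S finS by auto
qed

section \<open>Beads\<close>

text \<open>These are the beta-numbers of \<open>\<alpha>\<close>, taken over all rows: zero parts
  contribute the beads \<open>- i\<close>, so partitions with different numbers of parts can be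
  compared directly.\<close>

definition bead :: "(nat \<Rightarrow> nat) \<Rightarrow> nat \<Rightarrow> int" where
  "bead \<alpha> i = int (\<alpha> i) - int i"

text \<open>One argument fixes both the residue class and the threshold, so passing from
  \<open>t\<close> to \<open>t + int n\<close> means passing to the next threshold in the same
  class.\<close>

definition bead_count :: "nat \<Rightarrow> (nat \<Rightarrow> nat) \<Rightarrow> int \<Rightarrow> nat" where
  "bead_count n \<alpha> t = card {i. t \<le> bead \<alpha> i \<and> int n dvd bead \<alpha> i - t}"

text \<open>Equivalently, in each residue class the beads \<open>a\<^sub>1 > a\<^sub>2 > \<dots>\<close> of \<open>\<lambda>\<close> and
  \<open>b\<^sub>1 > b\<^sub>2 > \<dots>\<close> of \<open>\<mu>\<close> satisfy \<open>a\<^sub>1 \<ge> b\<^sub>1 > a\<^sub>2 \<ge> b\<^sub>2 > \<dots>\<close>.\<close>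

definition interlaced :: "nat \<Rightarrow> (nat \<Rightarrow> nat) \<Rightarrow> (nat \<Rightarrow> nat) \<Rightarrow> bool" where
  "interlaced n lam mu \<longleftrightarrow> (\<forall>t. bead_count n mu t \<le> bead_count n lam t
     \<and> bead_count n lam t \<le> bead_count n mu (t + int n) + 1)"

lemma bead_less:
  assumes "antimono \<alpha>" "i < j"
  shows "bead \<alpha> j < bead \<alpha> i"
  using antimonoD[OF assms(1), of i j] assms(2) by (simp add: bead_def)

lemma bead_less_iff: "antimono \<alpha> \<Longrightarrow> bead \<alpha> j < bead \<alpha> i \<longleftrightarrow> i < j"
  by (metis bead_less linorder_neqE_nat order_less_asym)

lemma bead_le_iff: "antimono \<alpha> \<Longrightarrow> bead \<alpha> j \<le> bead \<alpha> i \<longleftrightarrow> i \<le> j"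
  by (metis bead_less_iff linorder_not_less)

lemma inj_bead: "antimono \<alpha> \<Longrightarrow> inj (bead \<alpha>)"
  by (metis bead_le_iff injI order_antisym order_refl)

lemma antimono_bead:
  assumes "\<And>i. bead \<alpha> (Suc i) < bead \<alpha> i"
  shows "antimono \<alpha>"
  unfolding antimono_iff_le_Suc
proof
  fix i show "\<alpha> (Suc i) \<le> \<alpha> i" using assms[of i] by (simp add: bead_def)
qed

lemma finite_beads_ge:
  assumes "antimono \<alpha>"
  shows "finite {i. t \<le> bead \<alpha> i}"
proof (rule finite_subset)
  show "{i. t \<le> bead \<alpha> i} \<subseteq> {..nat (int (\<alpha> 0) - t)}"
  proof
    fix i assume "i \<in> {i. t \<le> bead \<alpha> i}"
    then show "i \<in> {..nat (int (\<alpha> 0) - t)}"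
      using antimonoD[OF assms, of 0 i] by (simp add: bead_def)
  qed
qed simp

lemma finite_beads_ge_dvd: "antimono \<alpha> \<Longrightarrow> finite {i. t \<le> bead \<alpha> i \<and> P i}"
  by (rule finite_subset[OF _ finite_beads_ge[of \<alpha> t]]) auto

section \<open>Counting beads in residue classes\<close>

lemma bead_count_range:
  assumes "antimono \<alpha>"
  shows "bead_count n \<alpha> t = card {x \<in> range (bead \<alpha>). t \<le> x \<and> int n dvd x - t}"
proof -
  have "{x \<in> range (bead \<alpha>). t \<le> x \<and> int n dvd x - t}
      = bead \<alpha> ` {i. t \<le> bead \<alpha> i \<and> int n dvd bead \<alpha> i - t}" by auto
  then show ?thesis
    unfolding bead_count_def
    by (simp add: card_image inj_on_subset[OF inj_bead[OF assms]])
qed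

lemma next_in_class_iff:
  fixes t x :: int
  assumes "n > 0"
  shows "t + int n \<le> x \<and> int n dvd x - (t + int n) \<longleftrightarrow> t < x \<and> int n dvd x - t"
proof -
  have "int n dvd x - (t + int n) \<longleftrightarrow> int n dvd x - t"
    using dvd_add_triv_right_iff[of "int n" "x - (t + int n)"] by (simp add: algebra_simps)
  moreover have "t + int n \<le> x" if "t < x" "int n dvd x - t"
    using zdvd_imp_le[OF that(2)] that(1) by simp
  ultimately show ?thesis using assms by auto
qed

lemma bead_count_rec:
  assumes "antimono \<alpha>" "n > 0"
  shows "bead_count n \<alpha> t
    = bead_count n \<alpha> (t + int n) + (if t \<in> range (bead \<alpha>) then 1 else 0)"
proof -
  let ?X = "\<lambda>t. {x \<in> range (bead \<alpha>). t \<le> x \<and> int n dvd x - t}"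
  have "?X (t + int n) = {x \<in> range (bead \<alpha>). t < x \<and> int n dvd x - t}"
    by (simp add: next_in_class_iff[OF assms(2)])
  moreover have "finite {x \<in> range (bead \<alpha>). t < x \<and> int n dvd x - t}"
    by (rule finite_subset[OF _ finite_imageI[OF finite_beads_ge[OF assms(1), of t]], of _ "bead \<alpha>"]) auto
  moreover have "?X t = (if t \<in> range (bead \<alpha>) then insert t else id)
      {x \<in> range (bead \<alpha>). t < x \<and> int n dvd x - t}"
    by (auto simp: order_le_less)
  ultimately show ?thesis
    by (simp add: bead_count_range[OF assms(1)])
qed

text \<open>The thresholds from \<open>t\<close> to \<open>t + int n - 1\<close> represent every
  residue class once, and each bead from \<open>t\<close> on is at least the threshold of its class.
  Inequalities in the single classes thus become inequalities between total counts.\<close>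

lemma sum_bead_count:
  assumes "antimono \<alpha>" "n > 0"
  shows "(\<Sum>r<n. bead_count n \<alpha> (t + int r)) = card {i. t \<le> bead \<alpha> i}"
proof -
  let ?X = "\<lambda>r. {i. t + int r \<le> bead \<alpha> i \<and> int n dvd bead \<alpha> i - (t + int r)}"
  have X: "i \<in> ?X r \<longleftrightarrow> t \<le> bead \<alpha> i \<and> (bead \<alpha> i - t) mod int n = int r" if "r < n" for i r
  proof -
    have "int n dvd bead \<alpha> i - (t + int r) \<longleftrightarrow> (bead \<alpha> i - t) mod int n = int r"
      using that mod_eq_dvd_iff[of "bead \<alpha> i - t" "int n" "int r"] by (simp add: diff_diff_eq)
    moreover have "t + int r \<le> bead \<alpha> i" if "t \<le> bead \<alpha> i" "(bead \<alpha> i - t) mod int n = int r"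
      using zmod_le_nonneg_dividend[of "bead \<alpha> i - t" "int n"] that by simp
    ultimately show ?thesis by auto
  qed
  have "{i. t \<le> bead \<alpha> i} = (\<Union>r<n. ?X r)"
  proof (intro subset_antisym subsetI)
    fix i assume i: "i \<in> {i. t \<le> bead \<alpha> i}"
    define r where "r = nat ((bead \<alpha> i - t) mod int n)"
    have r: "r < n" unfolding r_def using assms(2) by (simp add: nat_less_iff)
    moreover have "int r = (bead \<alpha> i - t) mod int n"
      unfolding r_def using assms(2) by simp
    ultimately have "i \<in> ?X r" using X[OF r, of i] i by simp
    then show "i \<in> (\<Union>r<n. ?X r)" using r by blast
  qed auto
  also have "card \<dots> = (\<Sum>r<n. card (?X r))"
  proof (rule card_UN_disjoint)
    show "\<forall>r\<in>{..<n}. \<forall>s\<in>{..<n}. r \<noteq> s \<longrightarrow> ?X r \<inter> ?X s = {}"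
    proof (intro ballI impI)
      fix r s assume "r \<in> {..<n}" "s \<in> {..<n}" "r \<noteq> s"
      then have "\<not> (i \<in> ?X r \<and> i \<in> ?X s)" for i using X[of r i] X[of s i] by simp
      then show "?X r \<inter> ?X s = {}" by blast
    qed
  qed (simp_all add: finite_beads_ge_dvd[OF assms(1)])
  finally show ?thesis unfolding bead_count_def by (rule sym)
qed

text \<open>If row \<open>i\<close> of \<open>mu\<close> were longer than that of
  \<open>lam\<close>, then at the threshold \<open>bead mu i\<close> the partition \<open>mu\<close>
  would have at least \<open>i + 1\<close> beads and \<open>lam\<close> at most \<open>i\<close>,
  against the first inequality of interlacing summed over all classes.\<close>

lemma interlaced_imp_le:
  assumes "antimono lam" "antimono mu" "n > 0" "interlaced n lam mu"
  shows "mu \<le> lam"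
proof (rule le_funI, rule ccontr)
  fix i assume "\<not> mu i \<le> lam i"
  then have *: "bead lam i < bead mu i" by (simp add: bead_def)
  have "card {..i} \<le> card {j. bead mu i \<le> bead mu j}"
    using bead_le_iff[OF assms(2)] by (intro card_mono finite_beads_ge assms) auto
  also have "\<dots> \<le> card {j. bead mu i \<le> bead lam j}"
    using assms(4) unfolding sum_bead_count[OF assms(1,3), symmetric]
      sum_bead_count[OF assms(2,3), symmetric] interlaced_def by (intro sum_mono) auto
  also have "\<dots> \<le> card {..<i}"
  proof (rule card_mono)
    show "{j. bead mu i \<le> bead lam j} \<subseteq> {..<i}"
      using * bead_less_iff[OF assms(1)] by (auto dest: order_less_le_trans)
  qed simp
  finally show False by simp
qed

section \<open>Partitions and skew diagrams\<close>

lemma is_partition_le: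
  assumes "is_partition lam" "antimono \<alpha>" "\<alpha> \<le> lam"
  shows "is_partition \<alpha>"
proof -
  have "{i. \<alpha> i \<noteq> 0} \<subseteq> {i. lam i \<noteq> 0}" using assms(3) by (auto simp: le_fun_def intro: order_less_le_trans)
  then show ?thesis using assms finite_subset by (auto simp: is_partition_def)
qed

lemma part_eq_zero_iff:
  assumes "is_partition lam"
  shows "lam i = 0 \<longleftrightarrow> num_parts lam \<le> i"
proof -
  have fin: "finite {i. lam i \<noteq> 0}" and anti: "antimono lam"
    using assms by (auto simp: is_partition_def)
  obtain m where m: "lam m = 0" using ex_new_if_finite[OF infinite_UNIV_nat fin] by auto
  define l where "l = (LEAST m. lam m = 0)"
  have zero: "lam i = 0 \<longleftrightarrow> l \<le> i" for i
    using LeastI[of "\<lambda>m. lam m = 0", OF m] Least_le[of "\<lambda>m. lam m = 0" i] antimonoD[OF anti, of l i]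
    unfolding l_def by auto
  have "{i. lam i \<noteq> 0} = {..<l}" unfolding zero by auto
  then have "num_parts lam = l" by (simp add: num_parts_def)
  then show ?thesis using zero by simp
qed

lemma partition_size_sum:
  assumes "is_partition lam" "\<And>i. m \<le> i \<Longrightarrow> lam i = 0"
  shows "partition_size lam = (\<Sum>i<m. lam i)"
  unfolding partition_size_def
proof (rule sum.mono_neutral_left)
  show "{i. lam i \<noteq> 0} \<subseteq> {..<m}"
  proof
    fix i assume "i \<in> {i. lam i \<noteq> 0}"
    then show "i \<in> {..<m}" using assms(2)[of i] by (cases "m \<le> i") auto
  qed
qed auto

lemma
  assumes "is_partition lam" "is_partition mu" "mu \<le> lam"
  shows finite_skew_diagram: "finite (skew_diagram lam mu)"
    and card_skew_diagram: "card (skew_diagram lam mu) = skew_size lam mu"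
    and partition_size_mono: "partition_size mu \<le> partition_size lam"
proof -
  have lam0: "lam i = 0" if "num_parts lam \<le> i" for i
    using part_eq_zero_iff[OF assms(1)] that by simp
  then have mu0: "mu i = 0" if "num_parts lam \<le> i" for i
    using assms(3) that by (metis le_funD le_zero_eq)
  have eq: "skew_diagram lam mu = Sigma {..<num_parts lam} (\<lambda>i. {mu i..<lam i})"
  proof (intro subset_antisym subsetI)
    fix b assume "b \<in> skew_diagram lam mu"
    then show "b \<in> Sigma {..<num_parts lam} (\<lambda>i. {mu i..<lam i})"
      using lam0[of "fst b"] by (cases "num_parts lam \<le> fst b") (auto simp: skew_diagram_def)
  qed (auto simp: skew_diagram_def)
  show "finite (skew_diagram lam mu)" unfolding eq by simp
  have sizes: "partition_size lam = (\<Sum>i<num_parts lam. lam i)"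
      "partition_size mu = (\<Sum>i<num_parts lam. mu i)"
    using partition_size_sum[of lam] partition_size_sum[of mu] lam0 mu0 assms by blast+
  show "card (skew_diagram lam mu) = skew_size lam mu"
    unfolding eq skew_size_def sizes
    using assms(3) by (simp add: sum_subtractf_nat le_fun_def)
  show "partition_size mu \<le> partition_size lam"
    unfolding sizes
    using assms(3) by (simp add: sum_mono le_fun_def)
qed

text \<open>No box added to \<open>\<alpha>\<close> lies above a box of \<open>\<alpha>\<close>,
  since the rows of \<open>\<alpha>\<close> further up are at least as long. This carries the
  starting boxes of a shorter chain over to the extended one.\<close>

lemma top_boxes_mono:
  assumes "antimono \<alpha>" "\<alpha> \<le> lam" "b \<in> top_boxes (skew_diagram \<alpha> mu)"
  shows "b \<in> top_boxes (skew_diagram lam mu)"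
proof -
  obtain i j where b: "b = (i, j)" by force
  have ij: "mu i \<le> j" "j < \<alpha> i" and top: "\<And>i'. mu i' \<le> j \<Longrightarrow> j < \<alpha> i' \<Longrightarrow> i \<le> i'"
    using assms(3) by (auto simp: b top_boxes_def skew_diagram_def)
  have "i \<le> i'" if "mu i' \<le> j" for i'
    using top[OF that] antimonoD[OF assms(1), of i' i] ij by (cases "i' \<le> i") auto
  then show ?thesis
    using ij le_funD[OF assms(2), of i] by (auto simp: b top_boxes_def skew_diagram_def)
qed

section \<open>Border strips described row by row\<close>

locale ribbon =
  fixes lam \<alpha> :: "nat \<Rightarrow> nat" and p q :: nat
  assumes lam: "is_partition lam" and alpha: "is_partition \<alpha>" and p_le_q: "p \<le> q"
    and outside: "\<And>i. i < p \<or> q < i \<Longrightarrow> \<alpha> i = lam i"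
    \<comment> \<open>The last box of row \<open>Suc i\<close> and the first box of row
      \<open>i\<close> both lie in column \<open>\<alpha> i\<close>. Consecutive rows thus share
      exactly one column, which gives connectedness and excludes squares.\<close>
    and inside: "\<And>i. p \<le> i \<Longrightarrow> i < q \<Longrightarrow> lam (Suc i) = Suc (\<alpha> i)"
    and last_row: "\<alpha> q < lam q"
begin

lemma row_nonempty: "p \<le> i \<Longrightarrow> i \<le> q \<Longrightarrow> \<alpha> i < lam i"
  using inside[of i] last_row lam antimonoD[of lam i "Suc i"]
  by (cases "i = q") (auto simp: is_partition_def)

lemma alpha_le: "\<alpha> \<le> lam"
proof (rule le_funI)
  fix i show "\<alpha> i \<le> lam i" using outside[of i] row_nonempty[of i] by (cases "p \<le> i \<and> i \<le> q") auto
qed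

lemma box_row: "(i, j) \<in> skew_diagram lam \<alpha> \<Longrightarrow> p \<le> i \<and> i \<le> q"
  using outside[of i] by (cases "p \<le> i \<and> i \<le> q") (auto simp: skew_diagram_def)

lemma no_square: "\<not> {(i, j), (Suc i, j), (i, Suc j), (Suc i, Suc j)} \<subseteq> skew_diagram lam \<alpha>"
proof
  assume D: "{(i, j), (Suc i, j), (i, Suc j), (Suc i, Suc j)} \<subseteq> skew_diagram lam \<alpha>"
  then have "p \<le> i" "i < q" using box_row[of i j] box_row[of "Suc i" j] by auto
  then show False using D inside[of i] by (auto simp: skew_diagram_def)
qed

abbreviation steps :: "((nat \<times> nat) \<times> (nat \<times> nat)) set" where
  "steps \<equiv> {(x, y). x \<in> skew_diagram lam \<alpha> \<and> y \<in> skew_diagram lam \<alpha> \<and> adjacent_boxes x y}"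

lemma row_connected:
  assumes "\<alpha> i \<le> j" "j \<le> j'" "j' < lam i"
  shows "((i, j), (i, j')) \<in> steps\<^sup>*"
  using assms(2,3)
proof (induction j' rule: dec_induct)
  case (step m)
  have "((i, m), (i, Suc m)) \<in> steps"
    using step assms(1) by (simp add: skew_diagram_def adjacent_boxes_def)
  moreover have "((i, j), (i, m)) \<in> steps\<^sup>*" using step by simp
  ultimately show ?case by (rule rtrancl_into_rtrancl[rotated])
qed simp

text \<open>The path walks right to the end of its row, which lies directly below the first box of
  the row above, steps up, and repeats this until row \<open>p\<close> is reached.\<close>

lemma connected_to_start:
  assumes "p \<le> i" "i \<le> q" "\<alpha> i \<le> j" "j < lam i"
  shows "((i, j), (p, lam p - 1)) \<in> steps\<^sup>*"
  using assms
proof (induction i arbitrary: j rule: dec_induct)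
  case base
  then show ?case by (intro row_connected) auto
next
  case (step i)
  have last: "lam (Suc i) = Suc (\<alpha> i)" using inside step by simp
  have nonempty: "\<alpha> i < lam i" using row_nonempty step by simp
  have "((Suc i, j), (Suc i, \<alpha> i)) \<in> steps\<^sup>*"
    using step last by (intro row_connected) auto
  also have "((Suc i, \<alpha> i), (i, \<alpha> i)) \<in> steps"
    using step last nonempty by (simp add: skew_diagram_def adjacent_boxes_def)
  also have "((i, \<alpha> i), (p, lam p - 1)) \<in> steps\<^sup>*" using step nonempty by simp
  finally show ?case .
qed

lemma connected: "connected_boxes (skew_diagram lam \<alpha>)"
proof -
  have sym: "sym (steps\<^sup>*)"
    by (intro sym_rtrancl symI) (auto simp: adjacent_boxes_def abs_minus_commute)
  have start: "(b, (p, lam p - 1)) \<in> steps\<^sup>*" if "b \<in> skew_diagram lam \<alpha>" for b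
    using that box_row[of "fst b" "snd b"] connected_to_start[of "fst b" "snd b"]
    by (cases b) (auto simp: skew_diagram_def)
  show ?thesis
    unfolding connected_boxes_def
  proof (intro ballI)
    fix b c assume "b \<in> skew_diagram lam \<alpha>" "c \<in> skew_diagram lam \<alpha>"
    then show "(b, c) \<in> steps\<^sup>*"
      using rtrancl_trans[OF start symD[OF sym start]] by simp
  qed
qed

lemma border_strip: "border_strip (skew_size lam \<alpha>) (skew_diagram lam \<alpha>)"
  unfolding border_strip_def
proof (intro conjI notI)
  assume "\<exists>i j. {(i, j), (Suc i, j), (i, Suc j), (Suc i, Suc j)} \<subseteq> skew_diagram lam \<alpha>"
  then show False using no_square by (elim exE) (rule notE)
qed (fact connected card_skew_diagram[OF lam alpha alpha_le])+

lemma starting_box: "starting_box (skew_diagram lam \<alpha>) = (p, lam p - 1)"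
proof -
  have start: "(p, lam p - 1) \<in> skew_diagram lam \<alpha>"
    using row_nonempty[of p] p_le_q by (auto simp: skew_diagram_def)
  have extreme: "p \<le> i \<and> j \<le> lam p - 1" if "(i, j) \<in> skew_diagram lam \<alpha>" for i j
    using box_row[OF that] lam antimonoD[of lam p i] that
    by (auto simp: skew_diagram_def is_partition_def)
  show ?thesis
    unfolding starting_box_def
  proof (rule the_equality)
    show "(p, lam p - 1) \<in> skew_diagram lam \<alpha>
        \<and> (\<forall>c\<in>skew_diagram lam \<alpha>. fst (p, lam p - 1) \<le> fst c \<and> snd c \<le> snd (p, lam p - 1))"
      using start extreme by auto
    fix b assume b: "b \<in> skew_diagram lam \<alpha> \<and> (\<forall>c\<in>skew_diagram lam \<alpha>. fst b \<le> fst c \<and> snd c \<le> snd b)"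
    then show "b = (p, lam p - 1)"
      using start extreme[of "fst b" "snd b"] by (cases b) fastforce
  qed
qed

end

section \<open>Moving a bead\<close>

text \<open>The positions \<open>t - int n\<close> and \<open>t\<close> are neighbours in their
  class, so only the threshold \<open>t\<close> separates them; every other count sees both
  positions or neither.\<close>

lemma bead_count_move:
  assumes "antimono lam" "antimono \<alpha>" "n > 0"
    and t: "t \<in> range (bead lam)" "t - int n \<notin> range (bead lam)"
    and range: "range (bead \<alpha>) = insert (t - int n) (range (bead lam) - {t})"
  shows "bead_count n lam s = bead_count n \<alpha> s + (if s = t then 1 else 0)"
proof -
  let ?X = "\<lambda>\<beta>. {x \<in> range (bead \<beta>). s \<le> x \<and> int n dvd x - s}"
  have fin: "finite (?X \<beta>)" if "antimono \<beta>" for \<beta>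
    by (rule finite_subset[OF _ finite_imageI[OF finite_beads_ge[OF that, of s]], of _ "bead \<beta>"]) auto
  have shift: "int n dvd t - int n - s \<longleftrightarrow> int n dvd t - s"
    using dvd_add_triv_right_iff[of "int n" "t - int n - s"] by (simp add: algebra_simps)
  have le: "s \<le> t - int n" if "s < t" "int n dvd t - s"
    using zdvd_imp_le[OF that(2)] that(1) by simp
  consider "s = t" | "s < t" "int n dvd t - s" | "t < s \<or> \<not> int n dvd t - s" by linarith
  then show ?thesis
  proof cases
    case 1
    then have "?X lam = insert t (?X \<alpha>)" "t \<notin> ?X \<alpha>" using t range assms(3) by auto
    then show ?thesis using 1 fin[OF assms(2)] by (simp add: bead_count_range assms)
  next
    case 2
    then have "?X \<alpha> = insert (t - int n) (?X lam - {t})" using t range le shift by auto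
    moreover have tX: "t \<in> ?X lam" "t - int n \<notin> ?X lam - {t}" using 2 t by auto
    ultimately have "card (?X \<alpha>) = Suc (card (?X lam - {t}))"
      using card_insert_disjoint[OF finite_Diff[OF fin[OF assms(1)]] tX(2)] by simp
    also have "\<dots> = card (?X lam)" using card_Suc_Diff1[OF fin[OF assms(1)] tX(1)] .
    finally have "card (?X \<alpha>) = card (?X lam)" .
    then show ?thesis using 2 by (simp add: bead_count_range assms)
  next
    case 3
    then have "t \<notin> ?X lam" "t - int n \<notin> {x. s \<le> x \<and> int n dvd x - s}" using shift by auto
    then have "?X \<alpha> = ?X lam" unfolding range by blast
    moreover have "s \<noteq> t" using 3 by auto
    ultimately show ?thesis by (simp only: bead_count_range[OF assms(1)] bead_count_range[OF assms(2)]) simp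
  qed
qed

text \<open>This is the classical correspondence between moving a bead down to a vacant position and
  removing a border strip: sorting the beads again shifts those that were jumped over by one
  row.\<close>

lemma move_bead:
  assumes lam: "is_partition lam" and n: "n > 0"
    and vacant: "bead lam p - int n \<notin> range (bead lam)"
  obtains \<alpha> q where "ribbon lam \<alpha> p q" "skew_size lam \<alpha> = n"
    "range (bead \<alpha>) = insert (bead lam p - int n) (range (bead lam) - {bead lam p})"
proof -
  have anti: "antimono lam" using lam by (simp add: is_partition_def)
  define t where "t = bead lam p"
  define Q where "Q = {i. t - int n \<le> bead lam i}"
  \<comment> \<open>The moved bead lands in row \<open>q\<close>, the last row whose bead in
    \<open>lam\<close> is above the vacant position.\<close>
  define q where "q = Max Q"
  have finQ: "finite Q" unfolding Q_def by (rule finite_beads_ge[OF anti])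
  have pQ: "p \<in> Q" by (simp add: Q_def t_def)
  have pq: "p \<le> q" using finQ pQ by (simp add: q_def)
  have "q \<in> Q" using finQ pQ Max_in unfolding q_def by blast
  then have aq: "t - int n < bead lam q"
    using vacant unfolding Q_def t_def by (metis mem_Collect_eq order_le_less rangeI)
  have "Suc q \<notin> Q" using Max_ge[OF finQ, of "Suc q"] unfolding q_def by auto
  then have aSq: "bead lam (Suc q) < t - int n" unfolding Q_def by simp
  \<comment> \<open>The new beads in decreasing order: rows \<open>p\<close> to \<open>q - 1\<close>
    take over the bead of the next row, and row \<open>q\<close> receives the moved one.\<close>
  define c where "c i = (if i < p \<or> q < i then bead lam i
    else if i < q then bead lam (Suc i) else t - int n)" for i
  \<comment> \<open>These sums become the parts of \<open>\<alpha>\<close>. The bead of row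
    \<open>Suc q\<close> is at least \<open>- int (Suc q)\<close> and lies below
    \<open>t - int n\<close>, so \<open>t - int n + int q\<close> is nonnegative; hence
    \<open>lam q > 0\<close>, which covers the shifted rows.\<close>
  have nonneg: "0 \<le> c i + int i" for i
  proof (cases "i < p \<or> q < i")
    case True then show ?thesis by (auto simp: c_def bead_def)
  next
    case False
    have base: "0 \<le> t - int n + int q" using aSq by (simp add: bead_def)
    show ?thesis
    proof (cases "i < q")
      case True
      have "int (lam q) > 0" using aq base by (simp add: bead_def)
      then have "lam (Suc i) > 0" using antimonoD[OF anti, of "Suc i" q] True by simp
      then show ?thesis using True False by (simp add: c_def bead_def)
    next
      case False': False
      then show ?thesis using False base by (simp add: c_def)
    qed
  qed
  define \<alpha> where "\<alpha> i = nat (c i + int i)" for i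
  have bead_alpha: "bead \<alpha> i = c i" for i using nonneg[of i] by (simp add: \<alpha>_def bead_def)
  have c_le: "c i \<le> bead lam i" for i
    using bead_less[OF anti, of i "Suc i"] aq by (cases "i = q") (auto simp: c_def)
  have c_gt: "bead lam (Suc i) \<le> c i" for i
    using bead_less[OF anti, of i "Suc i"] aSq by (cases "i = q") (auto simp: c_def)
  \<comment> \<open>In \<open>c (Suc i) \<le> bead lam (Suc i) \<le> c i\<close> one inequality is
    strict: equality in the second means that row \<open>i\<close> was shifted, and then the first
    is strict.\<close>
  have "bead \<alpha> (Suc i) < bead \<alpha> i" for i
  proof (cases "c i = bead lam (Suc i)")
    case True
    then have "p \<le> i \<and> i < q"
      using bead_less[OF anti, of i "Suc i"] aSq pq by (auto simp: c_def split: if_splits)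
    then have "c (Suc i) < bead lam (Suc i)"
      using bead_less[OF anti, of "Suc i" "Suc (Suc i)"] aq
      by (cases "Suc i = q") (auto simp: c_def)
    then show ?thesis using True by (simp add: bead_alpha)
  next
    case False
    then show ?thesis using c_le[of "Suc i"] c_gt[of i] by (simp add: bead_alpha)
  qed
  then have anti': "antimono \<alpha>" by (rule antimono_bead)
  have le: "\<alpha> \<le> lam"
  proof (rule le_funI)
    fix i show "\<alpha> i \<le> lam i" using c_le[of i] bead_alpha[of i] by (simp add: bead_def)
  qed
  have alpha: "is_partition \<alpha>" using is_partition_le[OF lam anti' le] .
  have ribbon: "ribbon lam \<alpha> p q"
  proof
    show "\<alpha> i = lam i" if "i < p \<or> q < i" for i
      using bead_alpha[of i] that by (auto simp: c_def bead_def)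
    show "lam (Suc i) = Suc (\<alpha> i)" if "p \<le> i" "i < q" for i
      using bead_alpha[of i] that by (simp add: c_def bead_def)
    show "\<alpha> q < lam q"
      using bead_alpha[of q] aq pq by (simp add: c_def bead_def)
  qed (fact lam alpha pq)+
  have range: "range (bead \<alpha>) = insert (t - int n) (range (bead lam) - {t})"
  proof (intro subset_antisym subsetI)
    fix x assume "x \<in> range (bead \<alpha>)"
    then obtain i where i: "x = c i" using bead_alpha by auto
    have "bead lam i \<noteq> t" if "i < p \<or> q < i"
      using that pq inj_bead[OF anti] by (auto simp: t_def inj_eq)
    moreover have "bead lam (Suc i) \<noteq> t" if "p \<le> i"
      using that inj_bead[OF anti] by (auto simp: t_def inj_eq)
    ultimately show "x \<in> insert (t - int n) (range (bead lam) - {t})"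
      by (auto simp: i c_def)
  next
    fix x assume x: "x \<in> insert (t - int n) (range (bead lam) - {t})"
    show "x \<in> range (bead \<alpha>)"
    proof (cases "x = t - int n")
      case True
      then have "x = bead \<alpha> q" using pq by (simp add: bead_alpha c_def)
      then show ?thesis by simp
    next
      case False
      with x obtain i where i: "x = bead lam i" "i \<noteq> p" by (auto simp: t_def)
      have "x = bead \<alpha> (if i < p \<or> q < i then i else i - 1)"
        using i by (auto simp: bead_alpha c_def)
      then show ?thesis by blast
    qed
  qed
  define m where "m = max (num_parts lam) (Suc q)"
  have lam0: "lam i = 0" if "m \<le> i" for i
    using part_eq_zero_iff[OF lam] that by (simp add: m_def)
  then have alpha0: "\<alpha> i = 0" if "m \<le> i" for i
    using le that by (metis le_funD le_zero_eq)
  have sizes: "partition_size lam = (\<Sum>i<m. lam i)" "partition_size \<alpha> = (\<Sum>i<m. \<alpha> i)"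
    using partition_size_sum[of lam] partition_size_sum[of \<alpha>] lam0 alpha0 lam alpha by blast+
  \<comment> \<open>The shifted rows lose \<open>t - bead lam q\<close> boxes in total and row
    \<open>q\<close> loses \<open>bead lam q - (t - int n)\<close>, which adds up to
    \<open>n\<close>.\<close>
  have tele: "(\<Sum>i = p..<q. bead lam i - bead lam (Suc i)) = bead lam p - bead lam q"
    using sum_Suc_diff'[OF pq, of "\<lambda>i. - bead lam i"] by simp
  have "int (partition_size lam) - int (partition_size \<alpha>) = (\<Sum>i<m. bead lam i - c i)"
    unfolding sizes of_nat_sum sum_subtractf[symmetric]
    by (intro sum.cong) (auto simp: bead_alpha[symmetric] bead_def)
  also have "\<dots> = (\<Sum>i = p..q. bead lam i - c i)"
    by (rule sum.mono_neutral_right) (auto simp: c_def m_def)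
  also have "\<dots> = (\<Sum>i = p..<q. bead lam i - c i) + (bead lam q - c q)"
    using pq by (simp add: sum.last_plus add.commute flip: sum.atLeastLessThan_Suc atLeastLessThanSuc_atLeastAtMost)
  also have "(\<Sum>i = p..<q. bead lam i - c i) = (\<Sum>i = p..<q. bead lam i - bead lam (Suc i))"
    by (intro sum.cong) (auto simp: c_def)
  also have "\<dots> + (bead lam q - c q) = int n"
    using pq unfolding tele by (simp add: c_def t_def)
  finally have "skew_size lam \<alpha> = n" by (simp add: skew_size_def)
  then show ?thesis using ribbon range that unfolding t_def by blast
qed

text \<open>At the first bead \<open>t\<close> where the partitions differ, \<open>lam\<close> has a
  surplus of exactly one in its class. Moving this bead down lowers the count at \<open>t\<close>
  alone, to that of \<open>mu\<close>, so interlacing survives.\<close>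

lemma interlaced_remove_strip:
  assumes lam: "is_partition lam" and mu: "is_partition mu" and n: "n > 0"
    and inter: "interlaced n lam mu" and neq: "lam \<noteq> mu"
  obtains \<alpha> p q where "ribbon lam \<alpha> p q" "skew_size lam \<alpha> = n" "interlaced n \<alpha> mu"
    "\<And>i. i < p \<Longrightarrow> lam i = mu i"
proof -
  have anti: "antimono lam" "antimono mu" using lam mu by (auto simp: is_partition_def)
  define p where "p = (LEAST i. lam i \<noteq> mu i)"
  have p: "lam p \<noteq> mu p" using LeastI_ex[of "\<lambda>i. lam i \<noteq> mu i"] neq unfolding p_def by blast
  have before: "lam i = mu i" if "i < p" for i
    using not_less_Least[of i "\<lambda>i. lam i \<noteq> mu i"] that unfolding p_def by auto
  define t where "t = bead lam p"
  have mu_lt: "bead mu p < t"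
    using p le_funD[OF interlaced_imp_le[OF anti n inter], of p] by (simp add: t_def bead_def)
  let ?I = "\<lambda>\<beta>. {i. t \<le> bead \<beta> i \<and> int n dvd bead \<beta> i - t}"
  have ge_lam: "t \<le> bead lam i \<longleftrightarrow> i \<le> p" for i unfolding t_def using bead_le_iff[OF anti(1)] .
  have ge_mu: "t \<le> bead mu i \<longleftrightarrow> i < p" for i
  proof (cases "i < p")
    case True
    then show ?thesis using ge_lam[of i] before[of i] by (simp add: bead_def)
  next
    case False
    then show ?thesis using mu_lt bead_le_iff[OF anti(2), of i p] by simp
  qed
  have "i \<in> ?I lam \<longleftrightarrow> i \<in> insert p (?I mu)" for i
    using before[of i] ge_lam[of i] ge_mu[of i] by (cases "i = p") (auto simp: t_def bead_def)
  then have "?I lam = insert p (?I mu)" by blast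
  moreover have "p \<notin> ?I mu" using mu_lt by simp
  ultimately have at_t: "bead_count n lam t = bead_count n mu t + 1"
    unfolding bead_count_def using finite_beads_ge_dvd[OF anti(2)] by simp
  \<comment> \<open>From \<open>t - int n\<close> on, interlacing allows \<open>lam\<close> one bead
    more than \<open>mu\<close> has from \<open>t\<close> on, and the bead at \<open>t\<close>
    already uses up this allowance.\<close>
  have "bead_count n lam (t - int n) \<le> bead_count n mu t + 1"
    using inter unfolding interlaced_def by (metis diff_add_cancel)
  then have vacant: "t - int n \<notin> range (bead lam)"
    using bead_count_rec[OF anti(1) n, of "t - int n"] at_t by (auto split: if_splits)
  then obtain \<alpha> q where rib: "ribbon lam \<alpha> p q" and size: "skew_size lam \<alpha> = n"
    and range: "range (bead \<alpha>) = insert (t - int n) (range (bead lam) - {t})"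
    using move_bead[OF lam n] unfolding t_def by metis
  have anti': "antimono \<alpha>" using ribbon.alpha[OF rib] by (simp add: is_partition_def)
  have count: "bead_count n lam s = bead_count n \<alpha> s + (if s = t then 1 else 0)" for s
    using vacant range by (intro bead_count_move anti anti' n) (auto simp: t_def)
  have "interlaced n \<alpha> mu"
    unfolding interlaced_def
  proof
    fix s
    have "bead_count n mu s \<le> bead_count n lam s \<and> bead_count n lam s \<le> bead_count n mu (s + int n) + 1"
      using inter by (simp add: interlaced_def)
    then show "bead_count n mu s \<le> bead_count n \<alpha> s \<and> bead_count n \<alpha> s \<le> bead_count n mu (s + int n) + 1"
      using count[of s] at_t by (cases "s = t") auto
  qed
  then show ?thesis using that rib size before by blast
qed

section \<open>Interlaced partitions differ by a horizontal strip\<close>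

text \<open>The strip is appended at the end of the chain. Since \<open>lam\<close> and
  \<open>mu\<close> agree before row \<open>p\<close>, its starting box is a top box, and all boxes
  of \<open>\<alpha>\<close> outside \<open>mu\<close> lie weakly below row \<open>p\<close> and, by
  \<open>\<alpha> p < lam p\<close>, strictly to the left.\<close>

lemma horizontal_border_strip_extend:
  assumes strip: "horizontal_border_strip n k \<alpha> mu" and le: "mu \<le> \<alpha>"
    and rib: "ribbon lam \<alpha> p q" and size: "skew_size lam \<alpha> = n"
    and before: "\<And>i. i < p \<Longrightarrow> lam i = mu i"
  shows "horizontal_border_strip n (Suc k) lam mu"
proof -
  interpret ribbon lam \<alpha> p q by (rule rib)
  have anti: "antimono lam" "antimono \<alpha>" using lam alpha by (auto simp: is_partition_def)
  obtain \<beta> where b0: "\<beta> 0 = mu" and bk: "\<beta> k = \<alpha>" and part: "\<And>i. i \<le> k \<Longrightarrow> is_partition (\<beta> i)"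
    and step: "\<And>i. i \<in> {1..k} \<Longrightarrow> \<beta> (i - 1) \<le> \<beta> i
           \<and> border_strip n (skew_diagram (\<beta> i) (\<beta> (i - 1)))
           \<and> starting_box (skew_diagram (\<beta> i) (\<beta> (i - 1))) \<in> top_boxes (skew_diagram \<alpha> mu)"
    and sw: "\<And>i j. i \<in> {1..k} \<Longrightarrow> j \<in> {1..k} \<Longrightarrow> i < j \<Longrightarrow>
           southwest_of (starting_box (skew_diagram (\<beta> i) (\<beta> (i - 1))))
                        (starting_box (skew_diagram (\<beta> j) (\<beta> (j - 1))))"
    using strip unfolding horizontal_border_strip_def by blast
  define \<gamma> where "\<gamma> = \<beta>(Suc k := lam)"
  have row: "\<alpha> p < lam p" using row_nonempty p_le_q by simp
  have top: "(p, lam p - 1) \<in> top_boxes (skew_diagram lam mu)"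
  proof -
    have "p \<le> i" if "mu i \<le> lam p - 1" for i
      using that before[of i] antimonoD[OF anti(1), of i p] row by (cases "i < p") auto
    then show ?thesis
      using row le_funD[OF le, of p] by (auto simp: top_boxes_def skew_diagram_def)
  qed
  have left: "southwest_of b (p, lam p - 1)" if "b \<in> top_boxes (skew_diagram \<alpha> mu)" for b
  proof -
    have b: "mu (fst b) \<le> snd b" "snd b < \<alpha> (fst b)"
      using that by (auto simp: top_boxes_def skew_diagram_def)
    then have "p \<le> fst b" using before[of "fst b"] outside[of "fst b"] by (cases "fst b < p") auto
    then show ?thesis
      using b row antimonoD[OF anti(2), of p "fst b"] by (auto simp: southwest_of_def)
  qed
  have low: "\<gamma> i = \<beta> i \<and> \<gamma> (i - 1) = \<beta> (i - 1)" if "i \<in> {1..k}" for i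
    using that by (auto simp: \<gamma>_def)
  have new: "\<gamma> (Suc k) = lam" "\<gamma> (Suc k - 1) = \<alpha>" by (simp_all add: \<gamma>_def bk)
  show ?thesis
    unfolding horizontal_border_strip_def
  proof (intro exI[of _ \<gamma>] conjI ballI allI impI)
    show "\<gamma> 0 = mu" "\<gamma> (Suc k) = lam" by (simp_all add: \<gamma>_def b0)
    show "is_partition (\<gamma> i)" if "i \<le> Suc k" for i
      using that part[of i] lam by (cases "i = Suc k") (auto simp: \<gamma>_def)
  next
    fix i assume i: "i \<in> {1..Suc k}"
    consider "i = Suc k" | "i \<in> {1..k}" using i by force
    then have "\<gamma> (i - 1) \<le> \<gamma> i
        \<and> border_strip n (skew_diagram (\<gamma> i) (\<gamma> (i - 1)))
        \<and> starting_box (skew_diagram (\<gamma> i) (\<gamma> (i - 1))) \<in> top_boxes (skew_diagram lam mu)"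
    proof cases
      case 1
      then show ?thesis using new alpha_le border_strip size starting_box top by simp
    next
      case 2
      then show ?thesis
        using step[OF 2] low[OF 2] top_boxes_mono[OF anti(2) alpha_le] by simp
    qed
    then show "\<gamma> (i - 1) \<le> \<gamma> i"
      and "border_strip n (skew_diagram (\<gamma> i) (\<gamma> (i - 1)))"
      and "starting_box (skew_diagram (\<gamma> i) (\<gamma> (i - 1))) \<in> top_boxes (skew_diagram lam mu)"
      by blast+
  next
    fix i j assume i: "i \<in> {1..Suc k}" and j: "j \<in> {1..Suc k}" and ij: "i < j"
    then have i': "i \<in> {1..k}" by auto
    show "southwest_of (starting_box (skew_diagram (\<gamma> i) (\<gamma> (i - 1))))
                        (starting_box (skew_diagram (\<gamma> j) (\<gamma> (j - 1))))"
    proof (cases "j = Suc k")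
      case True
      then show ?thesis using left step[OF i'] low[OF i'] new starting_box by simp
    next
      case False
      then have "j \<in> {1..k}" using j by auto
      then show ?thesis using sw[OF i' _ ij] low[OF i'] low by simp
    qed
  qed
qed

text \<open>Each removal keeps the beads interlaced with those of \<open>mu\<close> and takes away
  \<open>n\<close> boxes; after \<open>k\<close> removals no box is left outside
  \<open>mu\<close>.\<close>

lemma interlaced_imp_horizontal_border_strip:
  assumes "is_partition lam" "is_partition mu" "n > 0" "interlaced n lam mu" "skew_size lam mu = k * n"
  shows "horizontal_border_strip n k lam mu"
  using assms
proof (induction k arbitrary: lam)
  case 0
  have anti: "antimono lam" "antimono mu" using 0 by (auto simp: is_partition_def)
  have le: "mu \<le> lam" using interlaced_imp_le[OF anti] 0 by blast
  have "skew_diagram lam mu = {}"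
    using card_skew_diagram[OF 0(1,2) le] finite_skew_diagram[OF 0(1,2) le] 0 by simp
  then have "lam i \<le> mu i" for i
    by (auto simp: skew_diagram_def not_less)
  then have "lam = mu" using le by (intro antisym) (auto simp: le_fun_def)
  then show ?case using 0 by (auto simp: horizontal_border_strip_def)
next
  case (Suc k)
  have "lam \<noteq> mu" using Suc.prems by (auto simp: skew_size_def)
  then obtain \<alpha> p q where rib: "ribbon lam \<alpha> p q" and size: "skew_size lam \<alpha> = n"
    and inter: "interlaced n \<alpha> mu" and before: "\<And>i. i < p \<Longrightarrow> lam i = mu i"
    using interlaced_remove_strip[OF Suc.prems(1-4)] by blast
  have alpha: "is_partition \<alpha>" by (rule ribbon.alpha[OF rib])
  have le: "mu \<le> \<alpha>"
    using interlaced_imp_le[OF _ _ _ inter] alpha Suc.prems by (auto simp: is_partition_def)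
  \<comment> \<open>\<open>skew_size\<close> is a truncated difference, so its additivity along
    \<open>mu \<le> \<alpha> \<le> lam\<close> rests on the monotonicity of
    \<open>partition_size\<close>.\<close>
  have "skew_size \<alpha> mu = k * n"
    using partition_size_mono[OF alpha Suc.prems(2) le] size Suc.prems(5)
      partition_size_mono[OF Suc.prems(1) alpha ribbon.alpha_le[OF rib]]
    by (simp add: skew_size_def)
  then have "horizontal_border_strip n k \<alpha> mu"
    using Suc.IH[OF alpha] Suc.prems inter by blast
  then show ?case
    by (rule horizontal_border_strip_extend[OF _ le rib size before])
qed

section \<open>Non-singular matrices have interlaced beads\<close>

lemma card_split_tail:
  assumes "finite {i. P i}"
  shows "card {i. P i} = card {i. i < l \<and> P i} + card {i::nat. l \<le> i \<and> P i}"
proof -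
  have "{i. P i} = {i. i < l \<and> P i} \<union> {i. l \<le> i \<and> P i}" by auto
  also have "card \<dots> = card {i. i < l \<and> P i} + card {i. l \<le> i \<and> P i}"
    using assms by (intro card_Un_disjoint) (auto elim: rev_finite_subset)
  finally show ?thesis .
qed

text \<open>A violated inequality yields too many columns supported in too few rows, or too many
  rows that vanish or agree outside too few columns. As the matrix sees only the first
  \<open>l\<close> rows, counts are split into a part inside the matrix and a tail.\<close>

lemma strip_matrix_nonsingular_interlaced:
  assumes lam: "is_partition lam" and mu: "is_partition mu" and le: "mu \<le> lam" and n: "n > 0"
    and det: "det (strip_matrix n lam mu) \<noteq> 0"
  shows "interlaced n lam mu"
  unfolding interlaced_def
proof (intro allI)
  fix t
  define l where "l = num_parts lam"
  define M where "M = strip_matrix n lam mu"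
  have anti: "antimono lam" "antimono mu" using lam mu by (auto simp: is_partition_def)
  have lam0: "lam i = 0" if "l \<le> i" for i
    using part_eq_zero_iff[OF lam] that by (simp add: l_def)
  then have mu0: "mu i = 0" if "l \<le> i" for i
    using le that by (metis le_funD le_zero_eq)
  have M: "M \<in> carrier_mat l l" by (simp add: M_def strip_matrix_def l_def)
  have entry: "M $$ (i, j) = (if bead mu j \<le> bead lam i \<and> int n dvd bead lam i - bead mu j then 1 else 0)"
    if "i < l" "j < l" for i j
    using that by (simp add: M_def strip_matrix_def l_def bead_def algebra_simps)
  define R where "R \<beta> s = {i. i < l \<and> s \<le> bead \<beta> i \<and> int n dvd bead \<beta> i - s}" for \<beta> s
  \<comment> \<open>The beads \<open>- i\<close> of zero parts beyond the matrix, common to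
    \<open>lam\<close> and \<open>mu\<close>.\<close>
  define tail where "tail s = card {i. l \<le> i \<and> s \<le> - int i \<and> int n dvd - int i - s}" for s
  have finR: "finite (R \<beta> s)" and subR: "R \<beta> s \<subseteq> {..<l}" for \<beta> s
    by (auto simp: R_def)
  have split: "bead_count n \<beta> s = card (R \<beta> s) + tail s"
    if "antimono \<beta>" "\<And>i. l \<le> i \<Longrightarrow> \<beta> i = 0" for \<beta> s
  proof -
    have "{i. l \<le> i \<and> s \<le> bead \<beta> i \<and> int n dvd bead \<beta> i - s}
        = {i. l \<le> i \<and> s \<le> - int i \<and> int n dvd - int i - s}"
      using that(2) by (auto simp: bead_def)
    then show ?thesis
      unfolding bead_count_def R_def tail_def
      using card_split_tail[OF finite_beads_ge_dvd[OF that(1), of s], of _ l] by simp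
  qed
  have same_class: "int n dvd x - t \<longleftrightarrow> int n dvd y - t" if "int n dvd x - y" for x y
    using dvd_add_right_iff[OF that, of "y - t"] by simp
  \<comment> \<open>A nonzero entry in a column of \<open>R mu t\<close> forces the bead of its row
    into the same class and above that of the column, hence the row into
    \<open>R lam t\<close>.\<close>
  have lower: "card (R mu t) \<le> card (R lam t)"
  proof (rule ccontr)
    assume "\<not> card (R mu t) \<le> card (R lam t)"
    then have "det M = 0"
    proof (intro det_zero_if_columns_supported[OF M subR finR])
      fix i j assume "j \<in> R mu t" "i < l" "i \<notin> R lam t"
      then show "M $$ (i, j) = 0"
        using entry[of i j] same_class[of "bead lam i" "bead mu j"] by (auto simp: R_def)
    qed simp
    then show False using det by (simp add: M_def)
  qed
  have next_R: "R mu (t + int n) = {j. j < l \<and> t < bead mu j \<and> int n dvd bead mu j - t}"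
    by (simp add: R_def next_in_class_iff[OF n])
  have upper: "card (R lam t) + tail t \<le> card (R mu (t + int n)) + tail (t + int n) + 1"
  proof (cases "t \<le> - int l")
    case True
    text \<open>Position \<open>t\<close> is now a common bead of both partitions outside the matrix, which uses up
      the summand 1. All beads of the class inside the matrix lie above \<open>t\<close>, so the rows of this
      class vanish outside its columns.\<close>
    have "card (R lam t) \<le> card (R mu (t + int n))"
    proof (rule ccontr)
      assume "\<not> card (R lam t) \<le> card (R mu (t + int n))"
      then have "det M = 0"
      proof (intro det_zero_if_rows_supported[OF M subR finR])
        fix i j assume ij: "i \<in> R lam t" "j < l" "j \<notin> R mu (t + int n)"
        then have "t < bead mu j" using True by (simp add: bead_def)
        then have "\<not> int n dvd bead mu j - t" using ij unfolding next_R by simp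
        then show "M $$ (i, j) = 0"
          using entry[of i j] same_class[of "bead lam i" "bead mu j"] ij by (auto simp: R_def)
      qed simp
      then show False using det by (simp add: M_def)
    qed
    moreover have "tail t \<le> tail (t + int n) + 1"
    proof -
      let ?I = "\<lambda>s. {i. l \<le> i \<and> s \<le> - int i \<and> int n dvd - int i - s}"
      have fin: "finite (?I s)" for s by (rule finite_subset[of _ "{..nat (- s)}"]) auto
      \<comment> \<open>The bead \<open>- i\<close> sits at position \<open>t\<close> exactly for
        the row \<open>i = nat (- t)\<close>, the only one counted at \<open>t\<close> but not at
        \<open>t + int n\<close>.\<close>
      have "?I t \<subseteq> insert (nat (- t)) (?I (t + int n))"
        by (auto simp: next_in_class_iff[OF n])
      then have "card (?I t) \<le> card (insert (nat (- t)) (?I (t + int n)))"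
        using fin by (intro card_mono) auto
      also have "\<dots> \<le> card (?I (t + int n)) + 1" using fin by (simp add: card_insert_if)
      finally show ?thesis by (simp add: tail_def)
    qed
    ultimately show ?thesis by simp
  next
    \<comment> \<open>Here \<open>t\<close> lies above all tail beads. For a row of
      \<open>R lam t\<close>, a column outside \<open>R mu (t + int n)\<close> has its bead at or
      below \<open>t\<close> or in another class, so its entry is 1 or 0 regardless of the
      row.\<close>
    case False
    have "card (R lam t) \<le> card (R mu (t + int n)) + 1"
    proof (rule ccontr)
      assume "\<not> card (R lam t) \<le> card (R mu (t + int n)) + 1"
      then have "det M = 0"
      proof (intro det_zero_if_rows_agree[OF M subR finR])
        fix i i' j assume ij: "i \<in> R lam t" "i' \<in> R lam t" "j < l" "j \<notin> R mu (t + int n)"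
        have "\<not> (t < bead mu j \<and> int n dvd bead mu j - t)" using ij unfolding next_R by simp
        moreover have "int n dvd bead lam i - bead mu j \<longleftrightarrow> int n dvd bead mu j - t"
          if "i \<in> R lam t" for i
          using that same_class[of "bead lam i" "bead mu j"]
            dvd_diff[of "int n" "bead lam i - t" "bead mu j - t"] by (auto simp: R_def)
        ultimately have "M $$ (i, j) = (if int n dvd bead mu j - t then 1 else 0)"
          if "i \<in> R lam t" for i
          using entry[of i j] that ij(3) by (auto simp: R_def)
        then show "M $$ (i, j) = M $$ (i', j)" using ij by simp
      qed simp
      then show False using det by (simp add: M_def)
    qed
    moreover have "{i. l \<le> i \<and> t \<le> - int i \<and> int n dvd - int i - t} = {}"
      using False by auto
    then have "tail t = 0" unfolding tail_def by (simp only: card.empty)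
    ultimately show ?thesis by simp
  qed
  have "bead_count n lam s = card (R lam s) + tail s" "bead_count n mu s = card (R mu s) + tail s" for s
    using split[of lam] split[of mu] lam0 mu0 anti by blast+
  then show "bead_count n mu t \<le> bead_count n lam t
      \<and> bead_count n lam t \<le> bead_count n mu (t + int n) + 1"
    using lower upper by simp
qed

theorem theorem3p10:
  fixes n k :: nat and lam mu :: "nat \<Rightarrow> nat"
  assumes "n > 0" and "k > 0"
    and "is_partition lam" and "is_partition mu"
    and "mu \<le> lam"
    and "skew_size lam mu = k * n"
    and "\<not> horizontal_border_strip n k lam mu"
  shows "det (strip_matrix n lam mu) = 0"
  using interlaced_imp_horizontal_border_strip[of lam mu n k]
    strip_matrix_nonsingular_interlaced[of lam mu n] assms by blast

end
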